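(* Let $p$ be a real monic polynomial of degree $k\ge 2$ having exactly $n$ real roots $\alpha_1<\dots<\alpha_n$, $1\le n\le k$, all of them simple, with secant map $S$. The map $\hat S:\mathbb T^2_\infty\setminus\mathcal Q\to\mathbb T^2_\infty\setminus\mathcal Q$ defines a smooth extension of $S$. Moreover, if $x_0\in\mathbb R$ satisfies $p'(x_0)=0$, then the point $(x_0,x_0)$ is periodic for $\hat S$ of minimal period three, namely $$(x_0,x_0)\mapsto(x_0,\infty)\mapsto(\infty,x_0)\mapsto(x_0,x_0).$$ The eigenvalues of $D\hat S^3(x_0,x_0)$ are $0$ and $1$ if the degree of the polynomial $p$ is greater than or equal to $3$.
   Context: Write $p(x)=\sum_{j=0}^k a_jx^j$ with $a_k=1$, and let $q(x,y)=\sum_{j=1}^k a_j\,(x^{j-1}+x^{j-2}y+\dots+xy^{j-2}+y^{j-1})$, the polynomial with $p(x)-p(y)=(x-y)q(x,y)$. Set $\delta_S=\{(x,y)\in\mathbb R^2: x\ne y,\ p(x)=p(y)\}\cup\{(x,x)\in\mathbb R^2: p'(x)=0\}$, which equals $\{q=0\}$. The secant map $S(x,y)=\left(y,\ y-p(y)\frac{y-x}{p(y)-p(x)}\right)$ is understood on $\mathbb R^2\setminus\delta_S$ (including diagonal points) as $S(x,y)=\left(y,\ \frac{y\,q(x,y)-p(y)}{q(x,y)}\right)$. Let $\mathcal Q=\{(\alpha_i,\alpha_j): 1\le i,j\le n,\ i\neq j\}\subset\delta_S$. The punctured torus is $$\mathbb T^2_\infty=\mathbb R^2\cup\{(x,\infty):x\in\mathbb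 R\}\cup\{(\infty,y):y\in\mathbb R\},$$ i.e. $(\mathbb R\cup\{\infty\})^2$ minus the point $(\infty,\infty)$, where $+\infty$ and $-\infty$ are identified to a single point $\infty$. Its smooth structure is given by the three charts: $\varphi_1=\mathrm{Id}$ on $\mathbb R^2$; $\varphi_2$ defined on $\{(x,y): x\in\mathbb R,\ y\in(\mathbb R\setminus\{0\})\cup\{\infty\}\}$ by $\varphi_2(x,y)=(x,1/y)$ for $y\ne\infty$ and $\varphi_2(x,\infty)=(x,0)$; and $\varphi_3$ defined on $\{(x,y): x\in(\mathbb R\setminus\{0\})\cup\{\infty\},\ y\in\mathbb R\}$ by $\varphi_3(x,y)=(1/x,y)$ for $x\neq\infty$ and $\varphi_3(\infty,y)=(0,y)$. The map $\hat S$ is defined by: $\hat S(x,y)=S(x,y)$ for $(x,y)\in\mathbb R^2\setminus\delta_S$; $\hat S(x,y)=(y,\infty)$ for $(x,y)\in\delta_S\setminus\mathcal Q$; $\hat S(x,\infty)=(\infty,x)$ for $x\in\mathbb R$; $\hat S(\infty,y)=(y,y)$ for $y\in\mathbb R$. "Smooth extension of $S$" means that $\hat S$ maps $\mathbb T^2_\infty\setminus\mathcal Q$ into itself, is $C^\infty$ with respect to the smooth structure on $\mathbb T^2_\infty$ given by the charts $\varphi_1,\varphi_2,\varphi_3$, and agrees with $S$ on $\mathbb R^2\setminus\delta_S$. *)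

theory Defs
  imports
    "HOL-Analysis.Analysis"
    "HOL-Computational_Algebra.Polynomial"
begin

subsection \<open>The secant map\<close>

definition secant_q :: "real poly \<Rightarrow> real \<Rightarrow> real \<Rightarrow> real" where
  "secant_q p x y = (\<Sum>j=1..degree p. coeff p j * (\<Sum>i<j. x ^ (j - 1 - i) * y ^ i))"

definition secant_delta :: "real poly \<Rightarrow> (real \<times> real) set" where
  "secant_delta p = {(x, y). x \<noteq> y \<and> poly p x = poly p y} \<union> {(x, x) | x. poly (pderiv p) x = 0}"

text \<open>Only meaningful off \<^term>\<open>secant_delta p\<close>; on the diagonal this is the Newton step.\<close>

definition secant_map :: "real poly \<Rightarrow> real \<times> real \<Rightarrow> real \<times> real" where
  "secant_map p = (\<lambda>(x, y). (y, (y * secant_q p x y - poly p y) / secant_q p x y))"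

lemma secant_q_factor: "poly p x - poly p y = (x - y) * secant_q p x y"
proof -
  have "poly p x - poly p y = (\<Sum>j\<le>degree p. coeff p j * (x ^ j - y ^ j))"
    by (simp add: poly_altdef sum_subtractf right_diff_distrib)
  also have "\<dots> = (\<Sum>j=1..degree p. coeff p j * (x ^ j - y ^ j))"
    by (rule sum.mono_neutral_right) (auto simp: not_le)
  also have "\<dots> = (\<Sum>j=1..degree p. (x - y) * (coeff p j * (\<Sum>i<j. x ^ (j - 1 - i) * y ^ i)))"
  proof (rule sum.cong[OF refl])
    fix j assume "j \<in> {1..degree p}"
    have "y ^ j - x ^ j = (y - x) * (\<Sum>i<j. x ^ (j - Suc i) * y ^ i)"
      by (rule power_diff_sumr2)
    then have "x ^ j - y ^ j = (x - y) * (\<Sum>i<j. x ^ (j - Suc i) * y ^ i)"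
      by (simp add: algebra_simps)
    then show "coeff p j * (x ^ j - y ^ j)
        = (x - y) * (coeff p j * (\<Sum>i<j. x ^ (j - 1 - i) * y ^ i))"
      by simp
  qed
  also have "\<dots> = (x - y) * secant_q p x y"
    by (simp add: secant_q_def sum_distrib_left)
  finally show ?thesis .
qed

lemma secant_q_diagonal: "secant_q p x x = poly (pderiv p) x"
proof -
  have "((\<lambda>x. \<Sum>j\<le>degree p. coeff p j * x ^ j) has_real_derivative
      (\<Sum>j\<le>degree p. coeff p j * (real j * x ^ (j - 1)))) (at x)"
    by (auto intro!: derivative_eq_intros sum.cong simp: ac_simps)
  then have "poly (pderiv p) x = (\<Sum>j\<le>degree p. coeff p j * (real j * x ^ (j - 1)))"
    using poly_DERIV[of p x] DERIV_unique by (fastforce simp: poly_altdef)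
  also have "\<dots> = (\<Sum>j=1..degree p. coeff p j * (real j * x ^ (j - 1)))"
    by (rule sum.mono_neutral_right) (auto simp: not_le)
  also have "\<dots> = secant_q p x x"
    unfolding secant_q_def
  proof (rule sum.cong[OF refl])
    fix j assume "j \<in> {1..degree p}"
    have "(\<Sum>i<j. x ^ (j - 1 - i) * x ^ i) = (\<Sum>i<j. x ^ (j - 1))"
      by (rule sum.cong) (auto simp flip: power_add)
    then show "coeff p j * (real j * x ^ (j - 1)) = coeff p j * (\<Sum>i<j. x ^ (j - 1 - i) * x ^ i)"
      by simp
  qed
  finally show ?thesis by simp
qed

lemma secant_delta_iff: "(x, y) \<in> secant_delta p \<longleftrightarrow> secant_q p x y = 0"
  using secant_q_factor[of p x y] secant_q_diagonal[of p x] by (auto simp: secant_delta_def)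

lemma secant_map_off_diagonal:
  assumes "(x, y) \<notin> secant_delta p" and "x \<noteq> y"
  shows "secant_map p (x, y) = (y, y - poly p y * ((y - x) / (poly p y - poly p x)))"
proof -
  have q: "secant_q p x y \<noteq> 0"
    using assms(1) by (simp add: secant_delta_iff)
  have "poly p y - poly p x = (y - x) * secant_q p x y"
    using secant_q_factor[of p x y] by (simp add: algebra_simps)
  then have "(y - x) / (poly p y - poly p x) = 1 / secant_q p x y"
    using assms(2) by simp
  then show ?thesis
    using q by (simp add: secant_map_def diff_divide_distrib)
qed


subsection \<open>The punctured torus\<close>

text \<open>The real line with one unsigned point at infinity.\<close>

datatype circle = Fin real | Infty

type_synonym torus_point = "circle \<times> circle"

definition punctured_torus :: "torus_point set" where
  "punctured_torus = UNIV - {(Infty, Infty)}"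

definition torus_embed :: "real \<times> real \<Rightarrow> torus_point" where
  "torus_embed = (\<lambda>(x, y). (Fin x, Fin y))"

text \<open>A chart is a pair of a domain and a map; the map is only relevant on the domain.\<close>

type_synonym chart = "torus_point set \<times> (torus_point \<Rightarrow> real \<times> real)"

fun fin_coord :: "circle \<Rightarrow> real" where
  "fin_coord (Fin x) = x"
| "fin_coord Infty = 0"

fun inv_coord :: "circle \<Rightarrow> real" where
  "inv_coord (Fin x) = 1 / x"
| "inv_coord Infty = 0"

definition chart1 :: chart where
  "chart1 = (range Fin \<times> range Fin, map_prod fin_coord fin_coord)"

definition chart2 :: chart where
  "chart2 = (range Fin \<times> (UNIV - {Fin 0}), map_prod fin_coord inv_coord)"

definition chart3 :: chart where
  "chart3 = ((UNIV - {Fin 0}) \<times> range Fin, map_prod inv_coord fin_coord)"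

definition torus_charts :: "chart set" where
  "torus_charts = {chart1, chart2, chart3}"

lemma torus_charts_cover: "(\<Union>(U, \<phi>)\<in>torus_charts. U) = punctured_torus"
proof -
  have "a = Infty" if "a \<notin> range Fin" for a
    using that by (cases a) auto
  then show ?thesis
    by (auto simp: torus_charts_def chart1_def chart2_def chart3_def punctured_torus_def)
qed

lemma torus_charts_inj_on:
  assumes "(U, \<phi>) \<in> torus_charts"
  shows "inj_on \<phi> U"
proof -
  have 1: "inj_on fin_coord (range Fin)"
    by (auto simp: inj_on_def)
  have 2: "inj_on inv_coord (UNIV - {Fin 0})"
  proof (rule inj_onI)
    fix a b assume "a \<in> UNIV - {Fin 0}" "b \<in> UNIV - {Fin 0}" "inv_coord a = inv_coord b"
    then show "a = b" by (cases a; cases b) auto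
  qed
  show ?thesis
    using assms map_prod_inj_on[OF 1 1] map_prod_inj_on[OF 1 2] map_prod_inj_on[OF 2 1]
    by (auto simp: torus_charts_def chart1_def chart2_def chart3_def)
qed


subsection \<open>Smoothness\<close>

text \<open>For open \<open>A\<close> these say that \<open>f\<close> is of class \<open>C\<^sup>n\<close>, respectively \<open>C\<^sup>\<infinity>\<close>, on \<open>A\<close>.\<close>

primrec Cn_on :: "nat \<Rightarrow> 'a::euclidean_space set \<Rightarrow> ('a \<Rightarrow> 'b::euclidean_space) \<Rightarrow> bool" where
  "Cn_on 0 A f \<longleftrightarrow> continuous_on A f"
| "Cn_on (Suc n) A f \<longleftrightarrow> (\<forall>a\<in>A. f differentiable (at a)) \<and>
      (\<forall>v. Cn_on n A (\<lambda>a. frechet_derivative f (at a) v))"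

definition smooth_on :: "'a::euclidean_space set \<Rightarrow> ('a \<Rightarrow> 'b::euclidean_space) \<Rightarrow> bool" where
  "smooth_on A f \<longleftrightarrow> (\<forall>n. Cn_on n A f)"

definition coord_rep ::
    "chart \<Rightarrow> chart \<Rightarrow> (torus_point \<Rightarrow> torus_point) \<Rightarrow> real \<times> real \<Rightarrow> real \<times> real" where
  "coord_rep c d f = snd d \<circ> f \<circ> inv_into (fst c) (snd c)"

definition coord_dom ::
    "chart \<Rightarrow> chart \<Rightarrow> torus_point set \<Rightarrow> (torus_point \<Rightarrow> torus_point) \<Rightarrow> (real \<times> real) set" where
  "coord_dom c d M f = snd c ` (M \<inter> fst c \<inter> f -` fst d)"

text \<open>Smoothness of \<open>f\<close> between open submanifolds \<open>M\<close> and \<open>N\<close> of the punctured torus.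
  The openness requirement makes \<open>f\<close> continuous for the topology defined by the charts
  (and forces \<open>M\<close> to be open).\<close>

definition smooth_map_between ::
    "torus_point set \<Rightarrow> torus_point set \<Rightarrow> (torus_point \<Rightarrow> torus_point) \<Rightarrow> bool" where
  "smooth_map_between M N f \<longleftrightarrow> f ` M \<subseteq> N \<and>
     (\<forall>c\<in>torus_charts. \<forall>d\<in>torus_charts.
        open (coord_dom c d M f) \<and> smooth_on (coord_dom c d M f) (coord_rep c d f))"

text \<open>\<open>D\<close> is the differential at \<open>P\<close> of \<open>f\<close> on \<open>M\<close>, read in the charts \<open>c\<close> around \<open>P\<close>
  and \<open>d\<close> around \<open>f P\<close>.\<close>

definition has_chart_derivative ::
    "torus_point set \<Rightarrow> chart \<Rightarrow> chart \<Rightarrow> (torus_point \<Rightarrow> torus_point) \<Rightarrow> torus_point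
      \<Rightarrow> (real \<times> real \<Rightarrow> real \<times> real) \<Rightarrow> bool" where
  "has_chart_derivative M c d f P D \<longleftrightarrow>
     P \<in> M \<inter> fst c \<and> f P \<in> fst d \<and> snd c P \<in> interior (coord_dom c d M f) \<and>
     (coord_rep c d f has_derivative D) (at (snd c P))"

definition eigenvalues :: "('a::real_vector \<Rightarrow> 'a) \<Rightarrow> real set" where
  "eigenvalues D = {c. \<exists>v. v \<noteq> 0 \<and> D v = c *\<^sub>R v}"

definition has_minimal_period :: "('a \<Rightarrow> 'a) \<Rightarrow> nat \<Rightarrow> 'a \<Rightarrow> bool" where
  "has_minimal_period f m P \<longleftrightarrow>
     0 < m \<and> (f ^^ m) P = P \<and> (\<forall>l. 0 < l \<and> l < m \<longrightarrow> (f ^^ l) P \<noteq> P)"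


subsection \<open>The extended secant map\<close>

definition focal_points :: "nat \<Rightarrow> (nat \<Rightarrow> real) \<Rightarrow> torus_point set" where
  "focal_points n \<alpha> = torus_embed ` {(\<alpha> i, \<alpha> j) | i j. i \<in> {1..n} \<and> j \<in> {1..n} \<and> i \<noteq> j}"

definition torus_regular :: "nat \<Rightarrow> (nat \<Rightarrow> real) \<Rightarrow> torus_point set" where
  "torus_regular n \<alpha> = punctured_torus - focal_points n \<alpha>"

text \<open>The map is meant on \<^const>\<open>torus_regular\<close>; its values at the focal points
  and at \<open>(\<infinity>, \<infinity>)\<close> are irrelevant.\<close>

fun secant_hat :: "real poly \<Rightarrow> torus_point \<Rightarrow> torus_point" where
  "secant_hat p (Fin x, Fin y) =
     (if (x, y) \<notin> secant_delta p then torus_embed (secant_map p (x, y)) else (Fin y, Infty))"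
| "secant_hat p (Fin x, Infty) = (Infty, Fin x)"
| "secant_hat p (Infty, Fin y) = (Fin y, Fin y)"
| "secant_hat p (Infty, Infty) = undefined"

end

theory Submission
  imports Defs
begin

text \<open>On the projective line the second coordinate of \<open>S\<close> is the ratio \<open>[y q(x, y) - p(y) : q(x, y)]\<close>.
  Near \<open>y = \<infinity>\<close>, multiplying both entries by \<open>v\<^bsup>k-1\<^esup>\<close> with \<open>v = 1/y\<close> gives a ratio of two
  polynomials \<open>[s H(s, v) - v\<^bsup>k-1\<^esup> p(s) : H(s, v)]\<close> at \<open>s = x\<close> with \<open>H(s, 0) = 1\<close>, and since \<open>q\<close> is
  symmetric the same ratio appears near \<open>x = \<infinity>\<close>. The two entries vanish simultaneously only at the
  focal points, because the roots are simple. Hence in every chart \<open>S\<close> extends by quotients of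
  polynomials with nonvanishing denominators. For \<open>k \<ge> 3\<close> the quotient is \<open>s + O(v\<^sup>2)\<close>, so the
  differential of the third iterate at a critical diagonal point is \<open>(a, b) \<mapsto> (b, b)\<close>.\<close>

subsection \<open>Calculus of smooth functions\<close>

text \<open>Derivatives are taken in the whole space, so openness of \<open>A\<close> is what makes
  them depend only on the values on \<open>A\<close>.\<close>

lemma Cn_on_cong:
  assumes "open A" and "\<And>a. a \<in> A \<Longrightarrow> f a = g a"
  shows "Cn_on n A f \<longleftrightarrow> Cn_on n A g"
  using assms(2)
proof (induction n arbitrary: f g)
  case 0
  then show ?case by (auto cong: continuous_on_cong)
next
  case (Suc n)
  have hd: "(f has_derivative D) (at a) \<longleftrightarrow> (g has_derivative D) (at a)" if "a \<in> A" for a D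
    using has_derivative_transform_within_open[OF _ \<open>open A\<close> that]
      Suc.prems by metis
  then have fd: "frechet_derivative f (at a) = frechet_derivative g (at a)" if "a \<in> A" for a
    using that by (simp add: frechet_derivative_def)
  have "Cn_on n A (\<lambda>a. frechet_derivative f (at a) v)
      \<longleftrightarrow> Cn_on n A (\<lambda>a. frechet_derivative g (at a) v)" for v
    by (rule Suc.IH) (simp add: fd)
  moreover have "f differentiable (at a) \<longleftrightarrow> g differentiable (at a)" if "a \<in> A" for a
    using hd[OF that] by (simp add: differentiable_def)
  ultimately show ?case by simp
qed

text \<open>Replaces the choice-defined \<open>frechet_derivative\<close> by any explicit derivative
  \<open>F\<close>, so that the closure proofs below can use the ordinary differentiation
  rules.\<close>

lemma Cn_on_SucI:
  assumes "open A" and "\<And>a. a \<in> A \<Longrightarrow> (f has_derivative F a) (at a)"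
    and "\<And>v. Cn_on n A (\<lambda>a. F a v)"
  shows "Cn_on (Suc n) A f"
proof -
  have "frechet_derivative f (at a) = F a" if "a \<in> A" for a
    using frechet_derivative_at[OF assms(2)[OF that]] by simp
  then have "Cn_on n A (\<lambda>a. frechet_derivative f (at a) v)" for v
    using Cn_on_cong[OF \<open>open A\<close>, of "\<lambda>a. frechet_derivative f (at a) v" "\<lambda>a. F a v"] assms(3)
    by simp
  then show ?thesis
    using assms(2) by (auto simp: differentiable_def)
qed

lemma Cn_on_Suc_has_derivative:
  assumes "Cn_on (Suc n) A f" and "a \<in> A"
  shows "(f has_derivative frechet_derivative f (at a)) (at a)"
  using assms by (simp add: frechet_derivative_works)

lemma Cn_on_Suc_imp: "Cn_on (Suc n) A f \<Longrightarrow> Cn_on n A f"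
proof (induction n arbitrary: f)
  case 0
  then have "f differentiable_on A"
    by (auto simp: differentiable_on_def intro: differentiable_at_withinI)
  then show ?case by (simp add: differentiable_imp_continuous_on)
qed simp

lemma Cn_on_const: "open A \<Longrightarrow> Cn_on n A (\<lambda>_. c)"
proof (induction n arbitrary: c)
  case (Suc n)
  then show ?case
    by (intro Cn_on_SucI[where F = "\<lambda>_ _. 0"]) auto
qed simp

lemma Cn_on_bounded_linear:
  assumes "open A" and "bounded_linear f"
  shows "Cn_on n A f"
proof (cases n)
  case 0
  then show ?thesis using assms(2) by (simp add: linear_continuous_on)
next
  case (Suc m)
  show ?thesis
    unfolding Suc using assms
    by (intro Cn_on_SucI[where F = "\<lambda>_. f"] bounded_linear_imp_has_derivative Cn_on_const)
qed

lemma Cn_on_add: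
  assumes "open A" and "Cn_on n A f" and "Cn_on n A g"
  shows "Cn_on n A (\<lambda>a. f a + g a)"
  using assms(2,3)
proof (induction n arbitrary: f g)
  case 0
  then show ?case by (simp add: continuous_on_add)
next
  case (Suc n)
  show ?case
    by (rule Cn_on_SucI[OF \<open>open A\<close> has_derivative_add[OF Cn_on_Suc_has_derivative Cn_on_Suc_has_derivative]])
      (use Suc in auto)
qed

lemma Cn_on_mult:
  fixes f g :: "'a::euclidean_space \<Rightarrow> real"
  assumes "open A" and "Cn_on n A f" and "Cn_on n A g"
  shows "Cn_on n A (\<lambda>a. f a * g a)"
  using assms(2,3)
proof (induction n arbitrary: f g)
  case 0
  then show ?case by (simp add: continuous_on_mult)
next
  case (Suc n)
  \<comment> \<open>The product rule contains \<open>f\<close> and \<open>g\<close> themselves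
    beside their derivatives, so both are also needed one order lower.\<close>
  have "Cn_on n A f" "Cn_on n A g"
    using Suc.prems by (blast intro: Cn_on_Suc_imp)+
  then show ?case
    by (intro Cn_on_SucI[OF \<open>open A\<close> has_derivative_mult[OF Cn_on_Suc_has_derivative Cn_on_Suc_has_derivative]]
        Cn_on_add[OF \<open>open A\<close>] Suc.IH)
      (use Suc.prems in auto)
qed

text \<open>The derivative of 1/f involves only f' and 1/f, and the latter is covered, one order
  lower, by the induction hypothesis.\<close>

lemma Cn_on_inverse:
  fixes f :: "'a::euclidean_space \<Rightarrow> real"
  assumes "open A" and "Cn_on n A f" and "\<And>a. a \<in> A \<Longrightarrow> f a \<noteq> 0"
  shows "Cn_on n A (\<lambda>a. inverse (f a))"
  using assms(2)
proof (induction n)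
  case 0
  then show ?case using assms(3) by (simp add: continuous_on_inverse)
next
  case (Suc n)
  then have IH: "Cn_on n A (\<lambda>a. inverse (f a))"
    by (blast intro: Cn_on_Suc_imp)
  have "((\<lambda>a. inverse (f a)) has_derivative
      (\<lambda>v. (- 1) * (inverse (f a) * (frechet_derivative f (at a) v * inverse (f a))))) (at a)" if "a \<in> A" for a
    using Deriv.has_derivative_inverse[OF assms(3)[OF that] Cn_on_Suc_has_derivative[OF Suc.prems that]]
    by (simp add: mult.assoc)
  moreover have "Cn_on n A (\<lambda>a. (- 1) * (inverse (f a) * (frechet_derivative f (at a) v * inverse (f a))))" for v
    using Suc.prems by (intro Cn_on_mult Cn_on_const IH \<open>open A\<close>) simp
  ultimately show ?case by (rule Cn_on_SucI[OF \<open>open A\<close>])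
qed

lemma Cn_on_Pair:
  assumes "open A" and "Cn_on n A f" and "Cn_on n A g"
  shows "Cn_on n A (\<lambda>a. (f a, g a))"
  using assms(2,3)
proof (induction n arbitrary: f g)
  case 0
  then show ?case by (simp add: continuous_on_Pair)
next
  case (Suc n)
  show ?case
    by (rule Cn_on_SucI[OF \<open>open A\<close> has_derivative_Pair[OF Cn_on_Suc_has_derivative Cn_on_Suc_has_derivative]])
      (use Suc in auto)
qed

section \<open>Closure rules for smooth functions\<close>

lemma smooth_on_fst: "open A \<Longrightarrow> smooth_on A fst"
  and smooth_on_snd: "open A \<Longrightarrow> smooth_on A snd"
  by (simp_all add: smooth_on_def Cn_on_bounded_linear bounded_linear_fst bounded_linear_snd)

lemma smooth_on_const: "open A \<Longrightarrow> smooth_on A (\<lambda>_. c)"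
  by (simp add: smooth_on_def Cn_on_const)

lemma smooth_on_Pair:
  "open A \<Longrightarrow> smooth_on A f \<Longrightarrow> smooth_on A g \<Longrightarrow> smooth_on A (\<lambda>a. (f a, g a))"
  by (simp add: smooth_on_def Cn_on_Pair)

lemma smooth_on_add:
  "open A \<Longrightarrow> smooth_on A f \<Longrightarrow> smooth_on A g \<Longrightarrow> smooth_on A (\<lambda>a. f a + g a)"
  by (simp add: smooth_on_def Cn_on_add)

lemma smooth_on_sum:
  assumes "open A" and "\<And>i. i \<in> I \<Longrightarrow> smooth_on A (f i)"
  shows "smooth_on A (\<lambda>a. \<Sum>i\<in>I. f i a)"
  using assms(2)
  by (induction I rule: infinite_finite_induct) (simp_all add: smooth_on_const smooth_on_add \<open>open A\<close>)

context
  fixes A :: "'a::euclidean_space set" and f :: "'a \<Rightarrow> real"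
  assumes A: "open A" and f: "smooth_on A f"
begin

lemma smooth_on_mult: "smooth_on A g \<Longrightarrow> smooth_on A (\<lambda>a. f a * g a)"
  using A f by (simp add: smooth_on_def Cn_on_mult)

lemma smooth_on_divide:
  assumes "smooth_on A g" and "\<And>a. a \<in> A \<Longrightarrow> g a \<noteq> 0"
  shows "smooth_on A (\<lambda>a. f a / g a)"
  using A f assms by (simp add: smooth_on_def divide_inverse Cn_on_mult Cn_on_inverse)

lemma smooth_on_diff:
  assumes "smooth_on A g"
  shows "smooth_on A (\<lambda>a. f a - g a)"
proof -
  have "Cn_on m A (\<lambda>a. f a + (- 1) * g a)" for m
    using A f assms unfolding smooth_on_def by (intro Cn_on_add Cn_on_mult Cn_on_const) auto
  then show ?thesis by (simp add: smooth_on_def)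
qed

lemma smooth_on_power: "smooth_on A (\<lambda>a. f a ^ m)"
  by (induction m) (simp_all add: A smooth_on_const smooth_on_mult)

lemma smooth_on_poly: "smooth_on A (\<lambda>a. poly p (f a))"
  by (induction p) (simp_all add: A smooth_on_const smooth_on_add smooth_on_mult)

end

lemma smooth_on_imp_continuous_on: "smooth_on A f \<Longrightarrow> continuous_on A f"
  unfolding smooth_on_def using Cn_on.simps(1) by blast

lemma smooth_on_imp_differentiable: "smooth_on A f \<Longrightarrow> a \<in> A \<Longrightarrow> f differentiable (at a)"
  unfolding smooth_on_def using Cn_on.simps(2)[of 0] by blast

lemmas smooth_intros = smooth_on_fst smooth_on_snd smooth_on_const smooth_on_Pair smooth_on_add
  smooth_on_sum smooth_on_mult smooth_on_diff smooth_on_power smooth_on_poly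


subsection \<open>Ratios on the circle\<close>

text \<open>The point [a : b] of the projective line. The indeterminate pair [0 : 0] falls to
  \<open>Infty\<close> by default and is excluded where the ratio is used for smoothness.\<close>

definition ratio :: "real \<Rightarrow> real \<Rightarrow> circle" where
  "ratio a b = (if b = 0 then Infty else Fin (a / b))"

lemma ratio_Fin: "b \<noteq> 0 \<Longrightarrow> ratio a b = Fin (a / b)"
  by (simp add: ratio_def)

text \<open>The next two equations hold without side conditions because \<open>x / 0 = 0\<close>.\<close>

lemma fin_coord_ratio: "fin_coord (ratio a b) = a / b"
  by (simp add: ratio_def)

lemma inv_coord_ratio: "inv_coord (ratio a b) = b / a"
  by (simp add: ratio_def)

lemma ratio_scale: "c \<noteq> 0 \<Longrightarrow> ratio (c * a) (c * b) = ratio a b"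
  by (simp add: ratio_def)

lemma ratio_in_range_Fin: "ratio a b \<in> range Fin \<longleftrightarrow> b \<noteq> 0"
  by (auto simp: ratio_def)

lemma ratio_eq_Fin_0: "ratio a b = Fin 0 \<longleftrightarrow> a = 0 \<and> b \<noteq> 0"
  by (auto simp: ratio_def)

text \<open>\<open>ratio 1 v\<close> is the point with inverse coordinate \<open>v\<close>,
  including \<open>Infty\<close> at \<open>v = 0\<close>; this gives inverses of
  \<open>chart2\<close> and \<open>chart3\<close> without case distinctions.\<close>

lemma chart_inverse:
  "(Fin x, Fin y) \<in> fst chart1" "snd chart1 (Fin x, Fin y) = (x, y)"
  "(Fin x, ratio 1 v) \<in> fst chart2" "snd chart2 (Fin x, ratio 1 v) = (x, v)"
  "(ratio 1 u, Fin y) \<in> fst chart3" "snd chart3 (ratio 1 u, Fin y) = (u, y)"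
  by (auto simp: chart1_def chart2_def chart3_def inv_coord_ratio ratio_eq_Fin_0)

text \<open>All three charts are onto the plane, so each chart has a globally defined inverse.\<close>

lemma coord_rep_eq:
  assumes c: "c \<in> torus_charts" and \<psi>: "\<And>z. \<psi> z \<in> fst c \<and> snd c (\<psi> z) = z"
  shows "coord_rep c d f z = snd d (f (\<psi> z))"
    and "coord_dom c d M f = {z. \<psi> z \<in> M \<and> f (\<psi> z) \<in> fst d}"
proof -
  have inj: "inj_on (snd c) (fst c)"
    using torus_charts_inj_on[of "fst c" "snd c"] c by simp
  have "inv_into (fst c) (snd c) z = \<psi> z" for z
    using inv_into_f_f[OF inj, of "\<psi> z"] \<psi>[of z] by simp
  then show "coord_rep c d f z = snd d (f (\<psi> z))"
    by (simp add: coord_rep_def)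
  have *: "P = \<psi> (snd c P)" if "P \<in> fst c" for P
    using inj_onD[OF inj] \<psi> that by metis
  show "coord_dom c d M f = {z. \<psi> z \<in> M \<and> f (\<psi> z) \<in> fst d}"
  proof (intro set_eqI iffI)
    fix z assume "z \<in> coord_dom c d M f"
    then show "z \<in> {z. \<psi> z \<in> M \<and> f (\<psi> z) \<in> fst d}"
      using * by (fastforce simp: coord_dom_def)
  next
    fix z assume "z \<in> {z. \<psi> z \<in> M \<and> f (\<psi> z) \<in> fst d}"
    then show "z \<in> coord_dom c d M f"
      unfolding coord_dom_def using \<psi>[of z] by (intro image_eqI[of _ _ "\<psi> z"]) auto
  qed
qed

text \<open>Settles all target charts at once: each coordinate of the image is a quotient of two of
  the four functions, and the chart domain says which denominators are nonzero. Hypothesis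
  \<open>M\<close> says that \<open>M\<close> omits exactly the points where the second ratio is
  [0 : 0].\<close>

lemma smooth_ratio_map:
  fixes a b a' b' :: "real \<times> real \<Rightarrow> real"
  assumes c: "c \<in> torus_charts" and \<psi>: "\<And>z. \<psi> z \<in> fst c \<and> snd c (\<psi> z) = z"
    and f: "\<And>z. f (\<psi> z) = (ratio (a z) (b z), ratio (a' z) (b' z))"
    and smooth: "\<And>A. open A \<Longrightarrow> smooth_on A a" "\<And>A. open A \<Longrightarrow> smooth_on A b"
      "\<And>A. open A \<Longrightarrow> smooth_on A a'" "\<And>A. open A \<Longrightarrow> smooth_on A b'"
    and ab: "\<And>z. a z \<noteq> 0 \<or> b z \<noteq> 0"
    and M: "\<And>z. \<psi> z \<in> M \<longleftrightarrow> a' z \<noteq> 0 \<or> b' z \<noteq> 0"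
    and d: "d \<in> torus_charts"
  shows "open (coord_dom c d M f) \<and> smooth_on (coord_dom c d M f) (coord_rep c d f)"
proof -
  have op: "open {z. h z \<noteq> 0 \<and> h' z \<noteq> 0}"
    if "continuous_on UNIV h" "continuous_on UNIV h'" for h h' :: "real \<times> real \<Rightarrow> real"
    using that by (intro open_Collect_conj open_Collect_neq) auto
  note cont = smooth[THEN smooth_on_imp_continuous_on, OF open_UNIV]
  have rep: "coord_rep c d f = (\<lambda>z. snd d (ratio (a z) (b z), ratio (a' z) (b' z)))"
    by (rule ext) (simp add: coord_rep_eq(1)[OF c \<psi>] f)
  consider "d = chart1" | "d = chart2" | "d = chart3"
    using d by (auto simp: torus_charts_def)
  then show ?thesis
  proof cases
    case 1
    have dom: "coord_dom c d M f = {z. b z \<noteq> 0 \<and> b' z \<noteq> 0}"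
      by (auto simp: coord_rep_eq(2)[OF c \<psi>] M f 1 chart1_def ratio_in_range_Fin)
    have "coord_rep c d f = (\<lambda>z. (a z / b z, a' z / b' z))"
      unfolding rep by (simp add: 1 chart1_def fin_coord_ratio)
    then show ?thesis
      unfolding dom using op cont by (auto intro!: smooth_on_Pair smooth_on_divide smooth)
  next
    case 2
    \<comment> \<open>On \<open>M\<close>, \<open>a' z = 0\<close> forces
      \<open>b' z \<noteq> 0\<close>, so the second coordinate is \<open>Fin 0\<close>, which
      \<open>chart2\<close> omits. Hypothesis \<open>ab\<close> does the same for the first
      coordinate in \<open>chart3\<close>.\<close>
    have dom: "coord_dom c d M f = {z. b z \<noteq> 0 \<and> a' z \<noteq> 0}"
      by (auto simp: coord_rep_eq(2)[OF c \<psi>] M f 2 chart2_def ratio_in_range_Fin ratio_eq_Fin_0)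
    have "coord_rep c d f = (\<lambda>z. (a z / b z, b' z / a' z))"
      unfolding rep by (simp add: 2 chart2_def fin_coord_ratio inv_coord_ratio)
    then show ?thesis
      unfolding dom using op cont by (auto intro!: smooth_on_Pair smooth_on_divide smooth)
  next
    case 3
    have dom: "coord_dom c d M f = {z. a z \<noteq> 0 \<and> b' z \<noteq> 0}"
      using ab by (auto simp: coord_rep_eq(2)[OF c \<psi>] M f 3 chart3_def ratio_in_range_Fin ratio_eq_Fin_0)
    have "coord_rep c d f = (\<lambda>z. (b z / a z, a' z / b' z))"
      unfolding rep by (simp add: 3 chart3_def fin_coord_ratio inv_coord_ratio)
    then show ?thesis
      unfolding dom using op cont by (auto intro!: smooth_on_Pair smooth_on_divide smooth)
  qed
qed


subsection \<open>The secant map in homogeneous form\<close>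

definition secant_num :: "real poly \<Rightarrow> real \<Rightarrow> real \<Rightarrow> real" where
  "secant_num p x y = y * secant_q p x y - poly p y"

text \<open>This is t^(k-1) q(s, 1/t) with the powers of t already combined. Since i < j \<le> k, no
  exponent is negative, so the polynomial also makes sense at t = 0.\<close>

definition secant_q_inf :: "real poly \<Rightarrow> real \<Rightarrow> real \<Rightarrow> real" where
  "secant_q_inf p s t =
     (\<Sum>j=1..degree p. coeff p j * (\<Sum>i<j. s ^ (j - 1 - i) * t ^ (degree p - 1 - i)))"

text \<open>Built from the form s q - p(s) of the numerator, so that p is never evaluated at
  1/t.\<close>

definition secant_num_inf :: "real poly \<Rightarrow> real \<Rightarrow> real \<Rightarrow> real" where
  "secant_num_inf p s t = s * secant_q_inf p s t - t ^ (degree p - 1) * poly p s"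

lemma secant_q_commute: "secant_q p x y = secant_q p y x"
proof (cases "x = y")
  case False
  have "(x - y) * secant_q p x y = (x - y) * secant_q p y x"
    using secant_q_factor[of p x y] secant_q_factor[of p y x] by (simp add: algebra_simps)
  then show ?thesis using False by simp
qed simp

text \<open>The two forms of the numerator differ by (x - y) q(x, y) - (p(x) - p(y)) = 0.\<close>

lemma secant_num_alt: "secant_num p x y = x * secant_q p x y - poly p x"
  using secant_q_factor[of p x y] by (simp add: secant_num_def algebra_simps)

lemma secant_num_commute: "secant_num p x y = secant_num p y x"
  by (metis secant_num_alt secant_num_def secant_q_commute)

lemma secant_q_inf_eq:
  assumes "t \<noteq> 0"
  shows "secant_q_inf p s t = t ^ (degree p - 1) * secant_q p s (1 / t)"
proof -
  \<comment> \<open>The bound on \<open>i\<close> keeps the truncated subtraction exact.\<close>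
  have pow: "t ^ (degree p - 1 - i) = t ^ (degree p - 1) * (1 / t) ^ i" if "i < degree p" for i
    using that assms by (simp add: power_diff power_one_over)
  have inner: "(\<Sum>i<j. s ^ (j - 1 - i) * t ^ (degree p - 1 - i))
      = t ^ (degree p - 1) * (\<Sum>i<j. s ^ (j - 1 - i) * (1 / t) ^ i)" if "j \<le> degree p" for j
    unfolding sum_distrib_left
  proof (rule sum.cong[OF refl])
    fix i assume "i \<in> {..<j}"
    then have "i < degree p" using that by simp
    then show "s ^ (j - 1 - i) * t ^ (degree p - 1 - i) = t ^ (degree p - 1) * (s ^ (j - 1 - i) * (1 / t) ^ i)"
      by (simp only: pow mult.left_commute)
  qed
  have "secant_q_inf p s t
      = (\<Sum>j=1..degree p. t ^ (degree p - 1) * (coeff p j * (\<Sum>i<j. s ^ (j - 1 - i) * (1 / t) ^ i)))"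
    unfolding secant_q_inf_def
  proof (rule sum.cong[OF refl])
    fix j assume "j \<in> {1..degree p}"
    then have "j \<le> degree p" by simp
    then show "coeff p j * (\<Sum>i<j. s ^ (j - 1 - i) * t ^ (degree p - 1 - i))
        = t ^ (degree p - 1) * (coeff p j * (\<Sum>i<j. s ^ (j - 1 - i) * (1 / t) ^ i))"
      by (simp only: inner mult.left_commute)
  qed
  then show ?thesis
    by (simp only: secant_q_def sum_distrib_left[symmetric])
qed

lemma secant_num_inf_eq:
  assumes "t \<noteq> 0"
  shows "secant_num_inf p s t = t ^ (degree p - 1) * secant_num p s (1 / t)"
  by (simp add: secant_num_inf_def secant_q_inf_eq[OF assms] secant_num_alt algebra_simps)

text \<open>Only a factor 0^0 survives, which requires i = k - 1 and hence j = k; the power of s is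
  then s^0 and the coefficient is the leading one.\<close>

lemma secant_q_inf_0:
  assumes "lead_coeff p = 1" and "degree p \<ge> 1"
  shows "secant_q_inf p s 0 = 1"
proof -
  have "(\<Sum>i<j. s ^ (j - 1 - i) * 0 ^ (degree p - 1 - i)) = (if j = degree p then 1 else 0)"
    if "j \<in> {1..degree p}" for j
  proof -
    have "(\<Sum>i<j. s ^ (j - 1 - i) * 0 ^ (degree p - 1 - i))
        = (\<Sum>i<j. if i = degree p - 1 then s ^ (j - 1 - i) else 0)"
      using that by (intro sum.cong) (auto simp: power_0_left)
    also have "\<dots> = (if j = degree p then 1 else 0)"
      using that by auto
    finally show ?thesis .
  qed
  then have "secant_q_inf p s 0 = (\<Sum>j=1..degree p. if j = degree p then coeff p j else 0)"
    unfolding secant_q_inf_def by (intro sum.cong) auto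
  then show ?thesis using assms by simp
qed

text \<open>For k \<ge> 2 the factor t^(k-1) removes the p(s) term at t = 0.\<close>

lemma secant_num_inf_0:
  assumes "lead_coeff p = 1" and "degree p \<ge> 2"
  shows "secant_num_inf p s 0 = s"
  using assms by (simp add: secant_num_inf_def secant_q_inf_0 power_0_left)

text \<open>Both branches of the definition merge, since \<open>secant_delta\<close> is the zero set
  of q, where the ratio is \<open>Infty\<close>.\<close>

lemma secant_hat_finite: "secant_hat p (Fin x, Fin y) = (Fin y, ratio (secant_num p x y) (secant_q p x y))"
  by (simp add: secant_delta_iff ratio_def secant_map_def torus_embed_def secant_num_def)

declare secant_hat.simps(1)[simp del]

text \<open>For \<open>v \<noteq> 0\<close> both entries are scaled by v^(k-1). At
  \<open>v = 0\<close> the ratio is [x : 1], matching the prescribed value at (x,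
  \<infinity>).\<close>

lemma secant_hat_near_y_infinity:
  assumes "lead_coeff p = 1" and "degree p \<ge> 2"
  shows "secant_hat p (Fin x, ratio 1 v) = (ratio 1 v, ratio (secant_num_inf p x v) (secant_q_inf p x v))"
proof (cases "v = 0")
  case True
  then show ?thesis using assms by (simp add: ratio_def secant_num_inf_0 secant_q_inf_0)
next
  case False
  then have "ratio (secant_num_inf p x v) (secant_q_inf p x v)
      = ratio (secant_num p x (1 / v)) (secant_q p x (1 / v))"
    by (simp add: secant_num_inf_eq secant_q_inf_eq ratio_scale)
  then show ?thesis using False secant_hat_finite[of p x "1 / v"] by (simp add: ratio_def)
qed

text \<open>Symmetry of q and of the numerator reduces this to the same ratio with \<open>y\<close>
  and \<open>u\<close> as arguments.\<close>

lemma secant_hat_near_x_infinity: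
  assumes "lead_coeff p = 1" and "degree p \<ge> 2"
  shows "secant_hat p (ratio 1 u, Fin y) = (Fin y, ratio (secant_num_inf p y u) (secant_q_inf p y u))"
proof (cases "u = 0")
  case True
  then show ?thesis using assms by (simp add: ratio_def secant_num_inf_0 secant_q_inf_0)
next
  case False
  then have "ratio (secant_num_inf p y u) (secant_q_inf p y u)
      = ratio (secant_num p (1 / u) y) (secant_q p (1 / u) y)"
    by (simp add: secant_num_inf_eq secant_q_inf_eq ratio_scale
        secant_q_commute[of p y] secant_num_commute[of p y])
  then show ?thesis using False secant_hat_finite[of p "1 / u" y] by (simp add: ratio_def)
qed

lemma smooth_on_secant:
  assumes "open A" and "smooth_on A f" and "smooth_on A g"
  shows smooth_on_secant_q: "smooth_on A (\<lambda>z. secant_q p (f z) (g z))"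
    and smooth_on_secant_num: "smooth_on A (\<lambda>z. secant_num p (f z) (g z))"
    and smooth_on_secant_q_inf: "smooth_on A (\<lambda>z. secant_q_inf p (f z) (g z))"
    and smooth_on_secant_num_inf: "smooth_on A (\<lambda>z. secant_num_inf p (f z) (g z))"
  unfolding secant_num_def secant_num_inf_def secant_q_def secant_q_inf_def
  by (intro smooth_intros assms)+


subsection \<open>Focal points\<close>

context
  fixes p :: "real poly" and n :: nat and \<alpha> :: "nat \<Rightarrow> real"
  assumes lead: "lead_coeff p = 1" and deg: "degree p \<ge> 2"
    and inj: "inj_on \<alpha> {1..n}"
    and roots: "{x. poly p x = 0} = \<alpha> ` {1..n}"
    and simple: "\<forall>i\<in>{1..n}. order (\<alpha> i) p = 1"
begin

text \<open>Differentiation lowers the order of a root by one, so at a simple root the derivative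
  has order 0.\<close>

lemma pderiv_root_nonzero:
  assumes "poly p x = 0"
  shows "poly (pderiv p) x \<noteq> 0"
proof
  assume d: "poly (pderiv p) x = 0"
  have "p \<noteq> 0" "pderiv p \<noteq> 0"
    using deg by (auto simp: pderiv_eq_0_iff)
  moreover have "order x p = 1"
  proof -
    obtain i where "i \<in> {1..n}" "x = \<alpha> i"
      using assms roots by blast
    then show ?thesis using simple by blast
  qed
  ultimately have "order x (pderiv p) = 0"
    using assms order_pderiv[of p x] by simp
  then show False
    using d \<open>pderiv p \<noteq> 0\<close> by (simp add: order_root)
qed

lemma focal_iff:
  "(Fin x, Fin y) \<in> focal_points n \<alpha> \<longleftrightarrow> x \<noteq> y \<and> poly p x = 0 \<and> poly p y = 0"
proof -
  have root: "poly p x = 0 \<longleftrightarrow> (\<exists>i\<in>{1..n}. x = \<alpha> i)" for x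
    using roots by blast
  have "(Fin x, Fin y) \<in> focal_points n \<alpha>
      \<longleftrightarrow> (\<exists>i\<in>{1..n}. \<exists>j\<in>{1..n}. i \<noteq> j \<and> x = \<alpha> i \<and> y = \<alpha> j)"
    unfolding focal_points_def torus_embed_def image_iff by fastforce
  also have "\<dots> \<longleftrightarrow> (\<exists>i\<in>{1..n}. \<exists>j\<in>{1..n}. \<alpha> i \<noteq> \<alpha> j \<and> x = \<alpha> i \<and> y = \<alpha> j)"
    by (intro bex_cong refl) (simp add: inj_on_eq_iff[OF inj])
  also have "\<dots> \<longleftrightarrow> x \<noteq> y \<and> poly p x = 0 \<and> poly p y = 0"
    unfolding root by blast
  finally show ?thesis .
qed

text \<open>Focal points are exactly the indeterminacies [0 : 0]. If both entries vanish, then p(y)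
  = 0, and the factorisation gives p(x) = 0; the diagonal is excluded because there q = p', which is
  nonzero at a simple root.\<close>

lemma focal_iff_num_q:
  "(Fin x, Fin y) \<in> focal_points n \<alpha> \<longleftrightarrow> secant_num p x y = 0 \<and> secant_q p x y = 0"
proof -
  have "x \<noteq> y" if "secant_num p x y = 0" "secant_q p x y = 0"
    using that pderiv_root_nonzero[of x] secant_q_diagonal[of p x] by (auto simp: secant_num_def)
  then show ?thesis
    using secant_q_factor[of p x y]
    by (auto simp: focal_iff secant_num_def secant_num_alt)
qed

lemma Infty_not_focal: "(Infty, P) \<notin> focal_points n \<alpha>" "(P, Infty) \<notin> focal_points n \<alpha>"
  by (auto simp: focal_points_def torus_embed_def)

lemma regular_finite:
  "(Fin x, Fin y) \<in> torus_regular n \<alpha> \<longleftrightarrow> secant_num p x y \<noteq> 0 \<or> secant_q p x y \<noteq> 0"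
  by (auto simp: torus_regular_def punctured_torus_def focal_iff_num_q)

lemma regular_near_y_infinity:
  "(Fin x, ratio 1 v) \<in> torus_regular n \<alpha> \<longleftrightarrow> secant_num_inf p x v \<noteq> 0 \<or> secant_q_inf p x v \<noteq> 0"
proof (cases "v = 0")
  case True
  then show ?thesis using lead deg
    by (simp add: ratio_def torus_regular_def punctured_torus_def Infty_not_focal secant_q_inf_0)
next
  case False
  then show ?thesis using regular_finite[of x "1 / v"]
    by (simp add: ratio_def secant_num_inf_eq secant_q_inf_eq)
qed

lemma regular_near_x_infinity:
  "(ratio 1 u, Fin y) \<in> torus_regular n \<alpha> \<longleftrightarrow> secant_num_inf p y u \<noteq> 0 \<or> secant_q_inf p y u \<noteq> 0"
proof (cases "u = 0")
  case True
  then show ?thesis using lead deg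
    by (simp add: ratio_def torus_regular_def punctured_torus_def Infty_not_focal secant_q_inf_0)
next
  case False
  then show ?thesis using regular_finite[of "1 / u" y]
    by (simp add: ratio_def secant_num_inf_eq secant_q_inf_eq
        secant_q_commute[of p y] secant_num_commute[of p y])
qed

lemma secant_hat_regular:
  assumes "P \<in> torus_regular n \<alpha>"
  shows "secant_hat p P \<in> torus_regular n \<alpha>"
proof -
  obtain a b where P: "P = (a, b)" by (cases P)
  have diag: "(Fin y, Fin y) \<in> torus_regular n \<alpha>" for y
    by (simp add: torus_regular_def punctured_torus_def focal_iff)
  show ?thesis
  proof (cases a; cases b)
    fix x y assume ab: "a = Fin x" "b = Fin y"
    \<comment> \<open>A focal image would need p(y) = 0; but then the quotient equals y and the
      image lies on the diagonal.\<close>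
    have "(Fin y, Fin (secant_num p x y / secant_q p x y)) \<notin> focal_points n \<alpha>"
      if "secant_q p x y \<noteq> 0"
      using that by (auto simp: focal_iff secant_num_def)
    then show ?thesis
      unfolding P ab secant_hat_finite
      by (auto simp: ratio_def torus_regular_def punctured_torus_def Infty_not_focal)
  qed (use assms diag in \<open>auto simp: P torus_regular_def punctured_torus_def Infty_not_focal\<close>)
qed

lemma secant_hat_smooth:
  "smooth_map_between (torus_regular n \<alpha>) (torus_regular n \<alpha>) (secant_hat p)"
  unfolding smooth_map_between_def
proof (intro conjI[of "_ \<subseteq> _"] ballI)
  show "secant_hat p ` torus_regular n \<alpha> \<subseteq> torus_regular n \<alpha>"
    using secant_hat_regular by blast
next
  fix c d assume c: "c \<in> torus_charts" and d: "d \<in> torus_charts"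
  consider "c = chart1" | "c = chart2" | "c = chart3"
    using c by (auto simp: torus_charts_def)
  then show "open (coord_dom c d (torus_regular n \<alpha>) (secant_hat p)) \<and>
      smooth_on (coord_dom c d (torus_regular n \<alpha>) (secant_hat p)) (coord_rep c d (secant_hat p))"
  proof cases
    case 1
    show ?thesis
      by (rule smooth_ratio_map[OF c, where \<psi> = "\<lambda>z. (Fin (fst z), Fin (snd z))"
            and a = snd and b = "\<lambda>_. 1"
            and a' = "\<lambda>z. secant_num p (fst z) (snd z)" and b' = "\<lambda>z. secant_q p (fst z) (snd z)"])
        (simp_all add: 1 d chart_inverse ratio_Fin secant_hat_finite regular_finite
          smooth_intros smooth_on_secant)
  next
    case 2
    \<comment> \<open>The first image coordinate is the old second one, here [1 : v], so
      \<open>a\<close> is constant and \<open>b\<close> is the chart coordinate.\<close>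
    show ?thesis
      by (rule smooth_ratio_map[OF c, where \<psi> = "\<lambda>z. (Fin (fst z), ratio 1 (snd z))"
            and a = "\<lambda>_. 1" and b = snd
            and a' = "\<lambda>z. secant_num_inf p (fst z) (snd z)"
            and b' = "\<lambda>z. secant_q_inf p (fst z) (snd z)"])
        (simp_all add: 2 d chart_inverse regular_near_y_infinity
          secant_hat_near_y_infinity[OF lead deg] smooth_intros smooth_on_secant)
  next
    case 3
    show ?thesis
      by (rule smooth_ratio_map[OF c, where \<psi> = "\<lambda>z. (ratio 1 (fst z), Fin (snd z))"
            and a = snd and b = "\<lambda>_. 1"
            and a' = "\<lambda>z. secant_num_inf p (snd z) (fst z)"
            and b' = "\<lambda>z. secant_q_inf p (snd z) (fst z)"])
        (simp_all add: 3 d chart_inverse ratio_Fin regular_near_x_infinity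
          secant_hat_near_x_infinity[OF lead deg] smooth_intros smooth_on_secant)
  qed
qed


subsection \<open>The third iterate\<close>

text \<open>The ratio near infinity as a real number, with s split off so that the remainder visibly
  carries the factor t^(k-1).\<close>

definition secant_at_inf :: "real \<Rightarrow> real \<Rightarrow> real" where
  "secant_at_inf s t = s - t ^ (degree p - 1) * (poly p s / secant_q_inf p s t)"

lemma secant_at_inf_eq:
  "secant_q_inf p s t \<noteq> 0 \<Longrightarrow> secant_at_inf s t = secant_num_inf p s t / secant_q_inf p s t"
  by (simp add: secant_at_inf_def secant_num_inf_def field_simps)

text \<open>For k \<ge> 3 the factor t^(k-1) vanishes at t = 0 together with its derivative, so its
  product with a differentiable function contributes nothing.\<close>

lemma has_derivative_secant_at_inf:
  assumes "degree p \<ge> 3"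
  shows "((\<lambda>z. secant_at_inf (fst z) (snd z)) has_derivative fst) (at (s, 0))"
proof -
  define A where "A = {z. secant_q_inf p (fst z) (snd z) \<noteq> 0}"
  have "continuous_on UNIV (\<lambda>z::real\<times>real. secant_q_inf p (fst z) (snd z))"
    by (intro smooth_on_imp_continuous_on smooth_on_secant smooth_intros open_UNIV)
  then have A: "open A"
    unfolding A_def by (intro open_Collect_neq) auto
  have "smooth_on A (\<lambda>z. poly p (fst z) / secant_q_inf p (fst z) (snd z))"
    by (intro smooth_on_divide smooth_on_secant smooth_intros A) (simp add: A_def)
  moreover have "(s, 0) \<in> A"
    using lead deg by (simp add: A_def secant_q_inf_0)
  ultimately obtain e' where e':
    "((\<lambda>z. poly p (fst z) / secant_q_inf p (fst z) (snd z)) has_derivative e') (at (s, 0))"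
    using smooth_on_imp_differentiable unfolding differentiable_def by blast
  have "0 < degree p - 1 - 1" "0 < degree p - 1"
    using assms by auto
  then have "((\<lambda>z. snd z ^ (degree p - 1)) has_derivative (\<lambda>_. 0)) (at (s, 0 :: real))"
    by (auto intro!: derivative_eq_intros simp: power_0_left)
  from has_derivative_diff[OF has_derivative_fst[OF has_derivative_ident] has_derivative_mult[OF this e']]
  show ?thesis
    unfolding secant_at_inf_def using \<open>0 < degree p - 1\<close>
    by (simp add: power_0_left)
qed

text \<open>The orbit is (x, y), (y, [1 : v]), ([1 : v], w), (w, w'): the same \<open>v\<close>
  serves both later steps. The formula includes \<open>v = 0\<close>, where the orbit passes through
  infinity.\<close>

lemma secant_hat_cubed:
  assumes "secant_num p x y \<noteq> 0"
  defines "v \<equiv> secant_q p x y / secant_num p x y"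
  defines "w \<equiv> secant_at_inf y v"
  assumes "secant_q_inf p y v \<noteq> 0" and "secant_q_inf p w v \<noteq> 0"
  shows "(secant_hat p ^^ 3) (Fin x, Fin y) = (Fin w, Fin (secant_at_inf w v))"
proof -
  have "ratio (secant_num p x y) (secant_q p x y) = ratio 1 v"
    using assms(1) by (simp add: ratio_def v_def)
  then have 1: "secant_hat p (Fin x, Fin y) = (Fin y, ratio 1 v)"
    by (simp add: secant_hat_finite)
  have 2: "secant_hat p (Fin y, ratio 1 v) = (ratio 1 v, Fin w)"
    using assms(4) by (simp add: secant_hat_near_y_infinity[OF lead deg] w_def secant_at_inf_eq ratio_Fin)
  have 3: "secant_hat p (ratio 1 v, Fin w) = (Fin w, Fin (secant_at_inf w v))"
    using assms(5) by (simp add: secant_hat_near_x_infinity[OF lead deg] secant_at_inf_eq ratio_Fin)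
  show ?thesis
    by (simp add: numeral_3_eq_3 1 2 3)
qed

lemma secant_hat_cubed_derivative:
  assumes deg3: "degree p \<ge> 3" and crit: "poly (pderiv p) x\<^sub>0 = 0"
  shows "has_chart_derivative (torus_regular n \<alpha>) chart1 chart1 (secant_hat p ^^ 3)
    (Fin x\<^sub>0, Fin x\<^sub>0) (\<lambda>h. (snd h, snd h))"
proof -
  define N where "N z = secant_num p (fst z) (snd z)" for z
  define v where "v z = secant_q p (fst z) (snd z) / N z" for z
  define w where "w z = secant_at_inf (snd z) (v z)" for z
  define z\<^sub>0 where "z\<^sub>0 = (x\<^sub>0, x\<^sub>0)"
  \<comment> \<open>Here \<open>N\<close> equals -p(\<open>x\<^sub>0\<close>), and a critical point
    is not a root because all roots are simple.\<close>
  have N0: "N z\<^sub>0 \<noteq> 0"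
    using crit pderiv_root_nonzero[of x\<^sub>0]
    by (auto simp: N_def z\<^sub>0_def secant_num_def secant_q_diagonal)
  have v0: "v z\<^sub>0 = 0"
    using crit by (simp add: v_def z\<^sub>0_def secant_q_diagonal)
  have w0: "w z\<^sub>0 = x\<^sub>0"
    unfolding w_def v0 using deg by (simp add: secant_at_inf_def z\<^sub>0_def power_0_left)

  have smN: "smooth_on A N" if "open A" for A
    unfolding N_def by (intro smooth_on_secant smooth_intros that)
  have "smooth_on {z. N z \<noteq> 0} v" and "open {z. N z \<noteq> 0}"
  proof -
    show op: "open {z. N z \<noteq> 0}"
      using smooth_on_imp_continuous_on[OF smN[OF open_UNIV]] by (intro open_Collect_neq) auto
    show "smooth_on {z. N z \<noteq> 0} v"
      unfolding v_def by (intro smooth_on_divide smooth_on_secant smooth_intros smN op) simp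
  qed
  then obtain v' where v': "(v has_derivative v') (at z\<^sub>0)"
    using smooth_on_imp_differentiable[of _ v z\<^sub>0] N0 by (auto simp: differentiable_def)
  \<comment> \<open>At t = 0 the derivative of \<open>secant_at_inf\<close> is \<open>fst\<close>,
    so the chain rule discards \<open>v'\<close>, which never has to be computed. Applied to
    \<open>snd\<close> and then to \<open>w\<close>, this gives \<open>snd\<close> both
    times.\<close>
  have comp: "((\<lambda>z. secant_at_inf (g z) (v z)) has_derivative g') (at z\<^sub>0)"
    if "(g has_derivative g') (at z\<^sub>0)" for g g'
    using has_derivative_compose[OF has_derivative_Pair[OF that v'],
        of "\<lambda>z. secant_at_inf (fst z) (snd z)" fst]
      has_derivative_secant_at_inf[OF deg3] by (simp add: v0)
  have w': "(w has_derivative snd) (at z\<^sub>0)"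
    unfolding w_def by (rule comp) (auto intro!: derivative_eq_intros)
  have F': "((\<lambda>z. (w z, secant_at_inf (w z) (v z))) has_derivative (\<lambda>h. (snd h, snd h))) (at z\<^sub>0)"
    by (rule has_derivative_Pair[OF w' comp[OF w']])

  \<comment> \<open>At \<open>v = 0\<close> this polynomial equals 1, so by continuity it stays
    nonzero nearby.\<close>
  have q_inf: "\<forall>\<^sub>F z in nhds z\<^sub>0. secant_q_inf p (g z) (v z) \<noteq> 0" if "isCont g z\<^sub>0" for g
  proof -
    have "isCont (\<lambda>z. secant_q_inf p (g z) (v z)) z\<^sub>0"
      unfolding secant_q_inf_def
      by (intro continuous_intros that has_derivative_continuous[OF v'])
    moreover have "secant_q_inf p (g z\<^sub>0) (v z\<^sub>0) \<noteq> 0"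
      using lead deg by (simp add: v0 secant_q_inf_0)
    ultimately show ?thesis
      using tendsto_imp_eventually_ne by (simp add: isCont_def eventually_nhds_conv_at)
  qed
  have "\<forall>\<^sub>F z in nhds z\<^sub>0. N z \<noteq> 0"
    using eventually_nhds_in_open[OF \<open>open {z. N z \<noteq> 0}\<close>, of z\<^sub>0] N0 by simp
  then have ev: "\<forall>\<^sub>F z in nhds z\<^sub>0. N z \<noteq> 0 \<and> secant_q_inf p (snd z) (v z) \<noteq> 0
      \<and> secant_q_inf p (w z) (v z) \<noteq> 0"
    using has_derivative_continuous[OF w']
    by (intro eventually_conj q_inf continuous_intros)
  then obtain U where U: "open U" "z\<^sub>0 \<in> U"
    "\<And>z. z \<in> U \<Longrightarrow> N z \<noteq> 0 \<and> secant_q_inf p (snd z) (v z) \<noteq> 0 \<and> secant_q_inf p (w z) (v z) \<noteq> 0"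
    by (auto simp: eventually_nhds)
  have cubed: "(secant_hat p ^^ 3) (Fin (fst z), Fin (snd z))
      = (Fin (w z), Fin (secant_at_inf (w z) (v z)))" if "z \<in> U" for z
    using secant_hat_cubed[of "fst z" "snd z"] U(3)[OF that] by (simp add: N_def v_def w_def)
  have reg: "(Fin (fst z), Fin (snd z)) \<in> torus_regular n \<alpha>" if "z \<in> U" for z
    using U(3)[OF that] by (simp add: regular_finite N_def)

  note rep = coord_rep_eq[of chart1 "\<lambda>z. (Fin (fst z), Fin (snd z))"]
  have c1: "chart1 \<in> torus_charts" by (simp add: torus_charts_def)
  have "U \<subseteq> coord_dom chart1 chart1 (torus_regular n \<alpha>) (secant_hat p ^^ 3)"
    using reg cubed by (auto simp: rep(2)[OF c1] chart_inverse)
  then have int: "z\<^sub>0 \<in> interior (coord_dom chart1 chart1 (torus_regular n \<alpha>) (secant_hat p ^^ 3))"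
    using U by (auto simp: interior_def)
  have "(coord_rep chart1 chart1 (secant_hat p ^^ 3) has_derivative (\<lambda>h. (snd h, snd h))) (at z\<^sub>0)"
    using F' U(1,2)
    by (rule has_derivative_transform_within_open)
      (simp add: rep(1)[OF c1] chart_inverse cubed)
  moreover have "(secant_hat p ^^ 3) (Fin x\<^sub>0, Fin x\<^sub>0) \<in> fst chart1"
    using cubed[OF U(2)] by (simp add: z\<^sub>0_def chart_inverse)
  moreover have "(Fin x\<^sub>0, Fin x\<^sub>0) \<in> torus_regular n \<alpha>"
    using reg[OF U(2)] by (simp add: z\<^sub>0_def)
  ultimately show ?thesis
    using int by (simp add: has_chart_derivative_def chart_inverse z\<^sub>0_def)
qed

end

section \<open>Eigenvalues and the critical three-cycle\<close>

lemma eigenvalues_diagonal_projection: "eigenvalues (\<lambda>h::real \<times> real. (snd h, snd h)) = {0, 1}"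
proof -
  have "0 \<in> eigenvalues (\<lambda>h::real \<times> real. (snd h, snd h))"
    unfolding eigenvalues_def by (auto simp: zero_prod_def intro!: exI[of _ "(1, 0)"])
  moreover have "1 \<in> eigenvalues (\<lambda>h::real \<times> real. (snd h, snd h))"
    unfolding eigenvalues_def by (auto simp: zero_prod_def intro!: exI[of _ "(1, 1)"])
  moreover have "c \<in> {0, 1}" if "c \<in> eigenvalues (\<lambda>h::real \<times> real. (snd h, snd h))" for c
    using that by (auto simp: eigenvalues_def zero_prod_def)
  ultimately show ?thesis by blast
qed

text \<open>Since q(x, x) = p'(x), the critical point is sent to infinity. Both intermediate points
  have a coordinate \<open>Infty\<close>, which rules out a smaller period.\<close>

lemma secant_hat_critical_cycle:
  assumes "poly (pderiv p) x\<^sub>0 = 0"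
  shows "secant_hat p (Fin x\<^sub>0, Fin x\<^sub>0) = (Fin x\<^sub>0, Infty)"
    and "has_minimal_period (secant_hat p) 3 (Fin x\<^sub>0, Fin x\<^sub>0)"
proof -
  show 1: "secant_hat p (Fin x\<^sub>0, Fin x\<^sub>0) = (Fin x\<^sub>0, Infty)"
    using assms by (simp add: secant_hat_finite ratio_def secant_q_diagonal)
  show "has_minimal_period (secant_hat p) 3 (Fin x\<^sub>0, Fin x\<^sub>0)"
    unfolding has_minimal_period_def
  proof (intro conjI allI impI)
    show "(secant_hat p ^^ 3) (Fin x\<^sub>0, Fin x\<^sub>0) = (Fin x\<^sub>0, Fin x\<^sub>0)"
      by (simp add: numeral_3_eq_3 1)
    fix l :: nat assume "0 < l \<and> l < 3"
    then consider "l = 1" | "l = 2" by linarith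
    then show "(secant_hat p ^^ l) (Fin x\<^sub>0, Fin x\<^sub>0) \<noteq> (Fin x\<^sub>0, Fin x\<^sub>0)"
      by cases (simp_all add: numeral_2_eq_2 1)
  qed simp
qed

theorem theoremC:
  fixes p :: "real poly" and k n :: nat and \<alpha> :: "nat \<Rightarrow> real"
  assumes "lead_coeff p = 1" and "degree p = k" and "k \<ge> 2"
    and "1 \<le> n" and "n \<le> k"
    and "strict_mono_on {1..n} \<alpha>"
    and "{x. poly p x = 0} = \<alpha> ` {1..n}"
    and "\<forall>i\<in>{1..n}. order (\<alpha> i) p = 1"
  shows "smooth_map_between (torus_regular n \<alpha>) (torus_regular n \<alpha>) (secant_hat p)
    \<and> (\<forall>z. z \<notin> secant_delta p \<longrightarrow> torus_embed z \<in> torus_regular n \<alpha> \<and> secant_hat p (torus_embed z) = torus_embed (secant_map p z))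
    \<and> (\<forall>x\<^sub>0. poly (pderiv p) x\<^sub>0 = 0 \<longrightarrow>
         (Fin x\<^sub>0, Fin x\<^sub>0) \<in> torus_regular n \<alpha>
         \<and> has_minimal_period (secant_hat p) 3 (Fin x\<^sub>0, Fin x\<^sub>0)
         \<and> secant_hat p (Fin x\<^sub>0, Fin x\<^sub>0) = (Fin x\<^sub>0, Infty)
         \<and> secant_hat p (Fin x\<^sub>0, Infty) = (Infty, Fin x\<^sub>0)
         \<and> secant_hat p (Infty, Fin x\<^sub>0) = (Fin x\<^sub>0, Fin x\<^sub>0)
         \<and> (k \<ge> 3 \<longrightarrow>
              (\<exists>D. has_chart_derivative (torus_regular n \<alpha>) chart1 chart1 (secant_hat p ^^ 3) (Fin x\<^sub>0, Fin x\<^sub>0) D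
                 \<and> eigenvalues D = {0, 1})))"
proof -
  have inj: "inj_on \<alpha> {1..n}"
    using assms(6) by (rule strict_mono_on_imp_inj_on)
  have deg: "degree p \<ge> 2"
    using assms(2,3) by simp
  note hyps = assms(1) deg inj assms(7,8)
  have "torus_embed z \<in> torus_regular n \<alpha> \<and> secant_hat p (torus_embed z) = torus_embed (secant_map p z)"
    if "z \<notin> secant_delta p" for z
    using that
    by (cases z) (simp add: torus_embed_def regular_finite[OF hyps] secant_delta_iff secant_hat.simps(1))
  moreover have "(Fin x, Fin x) \<in> torus_regular n \<alpha>" for x
    by (simp add: torus_regular_def punctured_torus_def focal_iff[OF hyps])
  moreover have "\<exists>D. has_chart_derivative (torus_regular n \<alpha>) chart1 chart1 (secant_hat p ^^ 3) (Fin x, Fin x) D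
      \<and> eigenvalues D = {0, 1}" if "poly (pderiv p) x = 0" "k \<ge> 3" for x
    using secant_hat_cubed_derivative[OF hyps] eigenvalues_diagonal_projection assms(2) that by blast
  ultimately show ?thesis
    using secant_hat_smooth[OF hyps] secant_hat_critical_cycle by simp
qed

end
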